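(* Let $M\in\mathbb{C}^{n\times n}$ be an idempotent matrix ($M^2=M$) of rank $r$, and let $t=\operatorname{rank}(M)-\dim(\operatorname{null}(I-MM^H))$. Then, counted with multiplicity, $M$ has exactly $t$ singular values greater than $1$, exactly $r-t=\dim(\operatorname{null}(I-MM^H))$ singular values equal to $1$, and exactly $n-r$ singular values equal to $0$.
   Context: $X^H$ denotes the conjugate transpose and $\operatorname{null}$ the null space (kernel). *)

theory Defs
  imports
    "HOL-Computational_Algebra.Fundamental_Theorem_Algebra"
    "Jordan_Normal_Form.Char_Poly"
    "Jordan_Normal_Form.Schur_Decomposition"
    "Jordan_Normal_Form.Matrix_Kernel"
    "Jordan_Normal_Form.DL_Rank"
begin

text \<open>
  Singular values are the nonnegative square roots of the eigenvalues of $A^H A$, each repeated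
  according to its algebraic multiplicity. These eigenvalues are real and nonnegative, so
  \<open>Re\<close> only changes their type.
\<close>

definition singular_values :: "complex mat \<Rightarrow> real multiset" where
  "singular_values A =
    image_mset (\<lambda>z. sqrt (Re z)) (proots (char_poly (mat_adjoint A * A)))"

lemma size_singular_values:
  assumes "A \<in> carrier_mat m n"
  shows "size (singular_values A) = n"
proof -
  have "mat_adjoint A * A \<in> carrier_mat n n"
    using assms by (auto simp: mat_adjoint_def)
  from degree_monic_char_poly[OF this] show ?thesis
    by (simp add: singular_values_def size_proots_complex)
qed

end

(*
  The eigenvalues of M^H M counted by singular_values are semisimple because M^H M is self-adjoint,
  so their multiplicities are kernel dimensions. The kernel of M^H M is that of M, which settles the
  singular value 0. If M^H M v = e v with e nonzero, then v lies in the range of the idempotent M^H,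
  so M^H v = v; hence <Mv, v> = <v, v> and |Mv - v|^2 = |Mv|^2 - |v|^2 = (e - 1) |v|^2. This shows
  e >= 1, with equality iff moreover M v = v. The eigenspace for 1 is thus the set of common fixed
  points of M and M^H, which is symmetric in M and M^H and so is also the null space of I - M M^H.
*)
theory Submission
  imports Defs "Jordan_Normal_Form.Spectral_Radius" "Jordan_Normal_Form.Jordan_Normal_Form_Uniqueness"
begin

section \<open>Kernel dimension and rank-nullity\<close>

lemma kernel_dim_cong:
  assumes "dim_col A = dim_col B" "mat_kernel A = mat_kernel B"
  shows "kernel_dim A = kernel_dim B"
  using assms by (simp add: kernel_dim_def)

text \<open>Rank-nullity for the linear map given by multiplication with \<open>A\<close>: its image
  is the column space, whose dimension defines the rank, and its kernel is
  \<open>mat_kernel A\<close>.\<close>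

lemma rank_plus_kernel_dim:
  fixes A :: "'a :: field mat"
  assumes A: "A \<in> carrier_mat nr nc"
  shows "vec_space.rank nr A + kernel_dim A = nc"
proof -
  let ?V = "module_vec TYPE('a) nc" and ?W = "module_vec TYPE('a) nr"
  have vs: "vectorspace class_ring ?V" "vectorspace class_ring ?W"
    by (rule vec_vs)+
  have mh: "mod_hom class_ring ?V ?W (\<lambda>v. A *\<^sub>v v)"
    using A by (intro mod_hom.intro mod_hom_axioms.intro vec_module)
      (auto simp: LinearCombinations.module_hom_def mult_add_distrib_mat_vec mult_mat_vec module_vec_simps)
  have lm: "linear_map class_ring ?V ?W (\<lambda>v. A *\<^sub>v v)"
    by (rule linear_map.intro[OF vs mh])
  have ker: "mod_hom.ker ?V ?W (\<lambda>v. A *\<^sub>v v) = mat_kernel A"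
    using A by (auto simp: mod_hom.ker_def[OF mh] mat_kernel_def module_vec_simps)
  have im: "mod_hom.im ?V (\<lambda>v. A *\<^sub>v v) = vec_space.col_space nr A"
    using A vec_space.col_space_eq[OF A] by (auto simp: mod_hom.im_def[OF mh] module_vec_simps)
  show ?thesis
    using linear_map.rank_nullity[OF lm vec_space.fin_dim] A
    unfolding ker im vec_space.rank_def vec_space.dim_is_n kernel_dim_def  vec_space.col_space_def
    by simp
qed

section \<open>Jordan blocks and algebraic multiplicity\<close>

text \<open>Each term on the right of the assumption is at most the one on the left, so equal sums
  force \<open>min 2 n = min 1 n\<close> termwise, that is \<open>n\<close> at most 1. The list will
  hold the sizes of the Jordan blocks for one eigenvalue.\<close>

lemma sum_list_min_one_eq_sum_list:
  fixes ns :: "nat list"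
  assumes "(\<Sum>n\<leftarrow>ns. min 2 n) = (\<Sum>n\<leftarrow>ns. min 1 n)"
  shows "(\<Sum>n\<leftarrow>ns. min 1 n) = sum_list ns"
  using assms
proof (induction ns)
  case (Cons n ns)
  have "(\<Sum>n\<leftarrow>ns. min 1 n) \<le> (\<Sum>n\<leftarrow>ns. min 2 n)"
    by (intro sum_list_mono) auto
  with Cons.prems have "min 2 n = min 1 n" "(\<Sum>n\<leftarrow>ns. min 2 n) = (\<Sum>n\<leftarrow>ns. min 1 n)"
    by auto
  with Cons.IH show ?case by auto
qed simp

text \<open>The kernel condition says that no Jordan block for \<open>e\<close> has size greater than one.\<close>
lemma order_char_poly_eq_kernel_dim:
  fixes A :: "complex mat"
  assumes A: "A \<in> carrier_mat n n"
    and ker: "mat_kernel (char_matrix A e * char_matrix A e) = mat_kernel (char_matrix A e)"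
  shows "order e (char_poly A) = kernel_dim (char_matrix A e)"
proof -
  obtain n_as where jnf: "jordan_nf A n_as"
    using char_poly_factorized[OF A] jordan_nf_exists[OF A] by blast
  let ?ns = "map fst [(n, a)\<leftarrow>n_as. a = e]"
  have C: "char_matrix A e \<in> carrier_mat n n" using A by simp
  have pow: "char_matrix A e ^\<^sub>m 1 = char_matrix A e"
    "char_matrix A e ^\<^sub>m 2 = char_matrix A e * char_matrix A e"
    using C by (auto simp: numeral_2_eq_2)
  \<comment> \<open>The kernel of the k-th power of \<open>char_matrix A e\<close> has dimension the
    sum of \<open>min k n\<close> over the block sizes \<open>n\<close> for \<open>e\<close>, so
    comparing k = 1 with k = 2 detects every block larger than 1.\<close>
  have "dim_gen_eigenspace A e 2 = dim_gen_eigenspace A e 1"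
    unfolding dim_gen_eigenspace_def pow using C by (intro kernel_dim_cong ker) auto
  then have "(\<Sum>n\<leftarrow>?ns. min 2 n) = (\<Sum>n\<leftarrow>?ns. min 1 n)"
    unfolding dim_gen_eigenspace[OF jnf] .
  then have "(\<Sum>n\<leftarrow>?ns. min 1 n) = sum_list ?ns" by (rule sum_list_min_one_eq_sum_list)
  then have "dim_gen_eigenspace A e 1 = sum_list ?ns"
    unfolding dim_gen_eigenspace[OF jnf] .
  moreover have "order e (char_poly A) = sum_list ?ns"
    unfolding jordan_nf_order[OF jnf] by (simp add: case_prod_beta')
  ultimately show ?thesis by (simp add: dim_gen_eigenspace_def pow)
qed

section \<open>Conjugate transpose and inner product\<close>

lemma mat_adjoint_dim [simp]:
  "dim_row (mat_adjoint A) = dim_col A" "dim_col (mat_adjoint A) = dim_row A"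
  by (auto simp: mat_adjoint_def)

lemma mat_adjoint_carrier [simp]:
  "A \<in> carrier_mat nr nc \<Longrightarrow> mat_adjoint A \<in> carrier_mat nc nr"
  by (intro carrier_matI) auto

lemma mat_adjoint_index [simp]:
  "i < dim_col A \<Longrightarrow> j < dim_row A \<Longrightarrow> mat_adjoint A $$ (i, j) = conjugate (A $$ (j, i))"
  by (auto simp: mat_adjoint_def mat_of_rows_def)

lemma mat_adjoint_adjoint [simp]: "mat_adjoint (mat_adjoint A) = A"
  by (intro eq_matI) auto

lemma mat_adjoint_mult:
  assumes A: "A \<in> carrier_mat nr n" and B: "B \<in> carrier_mat n nc"
  shows "mat_adjoint (A * B) = mat_adjoint B * mat_adjoint A"
proof (rule eq_matI)
  fix i j assume "i < dim_row (mat_adjoint B * mat_adjoint A)" "j < dim_col (mat_adjoint B * mat_adjoint A)"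
  then have ij: "i < nc" "j < nr" using A B by auto
  have "mat_adjoint (A * B) $$ (i, j) = conjugate (\<Sum>k<n. A $$ (j, k) * B $$ (k, i))"
    using ij A B by (simp add: scalar_prod_def lessThan_atLeast0)
  also have "\<dots> = (\<Sum>k<n. conjugate (B $$ (k, i)) * conjugate (A $$ (j, k)))"
    by (simp add: sum_conjugate conjugate_dist_mul mult.commute)
  also have "\<dots> = (mat_adjoint B * mat_adjoint A) $$ (i, j)"
    using ij A B by (simp add: scalar_prod_def lessThan_atLeast0)
  finally show "mat_adjoint (A * B) $$ (i, j) = (mat_adjoint B * mat_adjoint A) $$ (i, j)" .
qed (use A B in auto)

lemma adjoint_sprod:
  fixes v w :: "'a :: conjugatable_field vec"
  assumes A: "A \<in> carrier_mat nr nc" and v: "v \<in> carrier_vec nc" and w: "w \<in> carrier_vec nr"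
  shows "(A *\<^sub>v v) \<bullet>c w = v \<bullet>c (mat_adjoint A *\<^sub>v w)"
proof -
  have "(A *\<^sub>v v) \<bullet>c w = (\<Sum>i<nr. \<Sum>j<nc. A $$ (i, j) * v $ j * conjugate (w $ i))"
    using assms by (auto simp: scalar_prod_def lessThan_atLeast0 sum_distrib_right intro!: sum.cong)
  also have "\<dots> = (\<Sum>j<nc. \<Sum>i<nr. A $$ (i, j) * v $ j * conjugate (w $ i))"
    by (rule sum.swap)
  also have "\<dots> = v \<bullet>c (mat_adjoint A *\<^sub>v w)"
    using assms
    by (auto simp: scalar_prod_def lessThan_atLeast0 sum_distrib_left sum_conjugate conjugate_dist_mul
        mult_ac intro!: sum.cong)
  finally show ?thesis .
qed

text \<open>If the product kills \<open>v\<close>, then |Av|^2 = <v, A^H A v> = 0. This serves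
  twice: for \<open>M\<close> at the singular value 0, and for shifted self-adjoint matrices to show
  semisimplicity.\<close>

lemma mat_kernel_adjoint_mult_self:
  fixes A :: "complex mat"
  assumes A: "A \<in> carrier_mat nr nc"
  shows "mat_kernel (mat_adjoint A * A) = mat_kernel A"
proof (intro antisym subsetI)
  fix v assume "v \<in> mat_kernel (mat_adjoint A * A)"
  then have v: "v \<in> carrier_vec nc" and 0: "mat_adjoint A * A *\<^sub>v v = 0\<^sub>v nc"
    using mat_kernelD[OF mult_carrier_mat[OF mat_adjoint_carrier[OF A] A]] by auto
  have "(A *\<^sub>v v) \<bullet>c (A *\<^sub>v v) = v \<bullet>c (mat_adjoint A * A *\<^sub>v v)"
    using adjoint_sprod[OF A v, of "A *\<^sub>v v"] A v
    by (simp add: assoc_mult_mat_vec[of _ nc nr])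
  also have "\<dots> = 0" using 0 v by simp
  finally have "A *\<^sub>v v = 0\<^sub>v nr"
    using A v by (subst (asm) conjugate_square_eq_0_vec[of _ nr]) auto
  with A v show "v \<in> mat_kernel A" by (intro mat_kernelI)
qed (use A mat_kernel_mult_subset[OF A, of "mat_adjoint A" nc] in auto)

lemma Re_sprod_self_nonneg: "Re (v \<bullet>c v) \<ge> 0"
  using conjugate_square_ge_0_vec[of v] by (auto simp: less_eq_complex_def)

text \<open>Nonnegativity in the order on complex numbers includes a vanishing imaginary
  part.\<close>

lemma sprod_self_eq_Re: "v \<bullet>c v = complex_of_real (Re (v \<bullet>c v))"
  using conjugate_square_ge_0_vec[of v] by (auto simp: less_eq_complex_def complex_eq_iff)

lemma Re_sprod_diff_self:
  fixes v w :: "complex vec"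
  assumes v: "v \<in> carrier_vec n" and w: "w \<in> carrier_vec n"
  shows "Re ((v - w) \<bullet>c (v - w)) = Re (v \<bullet>c v) - 2 * Re (v \<bullet>c w) + Re (w \<bullet>c w)"
proof -
  have sprod: "Re (x \<bullet>c y) = (\<Sum>i<n. Re (x $ i * cnj (y $ i)))"
    if "x \<in> carrier_vec n" "y \<in> carrier_vec n" for x y
    using that by (simp add: scalar_prod_def lessThan_atLeast0)
  have "Re ((v - w) \<bullet>c (v - w)) = (\<Sum>i<n. Re ((v $ i - w $ i) * cnj (v $ i - w $ i)))"
    using v w by (subst sprod) auto
  \<comment> \<open>The two cross terms are conjugate to each other, so their real parts
    agree.\<close>
  also have "\<dots> = (\<Sum>i<n. Re (v $ i * cnj (v $ i)) - 2 * Re (v $ i * cnj (w $ i)) + Re (w $ i * cnj (w $ i)))"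
    by (intro sum.cong refl) (simp add: algebra_simps)
  also have "\<dots> = Re (v \<bullet>c v) - 2 * Re (v \<bullet>c w) + Re (w \<bullet>c w)"
    unfolding sprod[OF v v] sprod[OF v w] sprod[OF w w] sum.distrib sum_subtractf sum_distrib_left ..
  finally show ?thesis .
qed

section \<open>Eigenspaces and fixed spaces as kernels\<close>

lemma char_matrix_mult_vec:
  assumes "A \<in> carrier_mat n n" "v \<in> carrier_vec n"
  shows "char_matrix A e *\<^sub>v v = A *\<^sub>v v - e \<cdot>\<^sub>v v"
proof -
  have "char_matrix A e *\<^sub>v v = A *\<^sub>v v + (- e) \<cdot>\<^sub>v v"
    using assms unfolding char_matrix_def
    by (subst add_mult_distrib_mat_vec[of _ n n]) (auto intro!: eq_vecI)
  with assms show ?thesis by auto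
qed

text \<open>For real \<open>e\<close> the matrix H - eI is again self-adjoint, so its square is its
  adjoint times itself and has the same kernel; hence all Jordan blocks for \<open>e\<close> have
  size 1.\<close>

lemma order_char_poly_selfadjoint:
  fixes H :: "complex mat"
  assumes H: "H \<in> carrier_mat n n" and adj: "mat_adjoint H = H" and e: "conjugate e = e"
  shows "order e (char_poly H) = kernel_dim (char_matrix H e)"
proof (rule order_char_poly_eq_kernel_dim[OF H])
  have entry: "cnj (H $$ (j, i)) = H $$ (i, j)" if "i < n" "j < n" for i j
    using mat_adjoint_index[of i H j] that H by (simp add: adj)
  have "mat_adjoint (char_matrix H e) = char_matrix H e"
    using H e by (intro eq_matI) (auto simp: char_matrix_def entry conjugate_dist_add)
  then show "mat_kernel (char_matrix H e * char_matrix H e) = mat_kernel (char_matrix H e)"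
    using mat_kernel_adjoint_mult_self[of "char_matrix H e" n n] H by simp
qed

lemma vec_minus_eq_zero_iff:
  fixes v w :: "'a :: ab_group_add vec"
  assumes "v \<in> carrier_vec n" "w \<in> carrier_vec n"
  shows "v - w = 0\<^sub>v n \<longleftrightarrow> v = w"
proof
  assume 0: "v - w = 0\<^sub>v n"
  show "v = w"
  proof (rule eq_vecI)
    fix i assume "i < dim_vec w"
    with assms arg_cong[OF 0, of "\<lambda>u. u $ i"] show "v $ i = w $ i" by simp
  qed (use assms in auto)
qed (use assms in auto)

lemma mat_kernel_char_matrix:
  assumes A: "A \<in> carrier_mat n n"
  shows "mat_kernel (char_matrix A e) = {v \<in> carrier_vec n. A *\<^sub>v v = e \<cdot>\<^sub>v v}"
proof -
  have "char_matrix A e *\<^sub>v v = 0\<^sub>v n \<longleftrightarrow> A *\<^sub>v v = e \<cdot>\<^sub>v v" if "v \<in> carrier_vec n" for v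
    using vec_minus_eq_zero_iff[of "A *\<^sub>v v" n "e \<cdot>\<^sub>v v"] char_matrix_mult_vec[OF A that, of e] that A
    by (metis mult_mat_vec_carrier smult_carrier_vec)
  then show ?thesis using mat_kernel[OF char_matrix_closed[OF A]] by auto
qed

lemma mat_kernel_one_minus:
  fixes A :: "'a :: field mat"
  assumes A: "A \<in> carrier_mat n n"
  shows "mat_kernel (1\<^sub>m n - A) = {v \<in> carrier_vec n. A *\<^sub>v v = v}"
proof -
  have "(1\<^sub>m n - A) *\<^sub>v v = 0\<^sub>v n \<longleftrightarrow> A *\<^sub>v v = v" if v: "v \<in> carrier_vec n" for v
  proof -
    have "(1\<^sub>m n - A) *\<^sub>v v = v - A *\<^sub>v v"
      using A v by (subst minus_mult_distrib_mat_vec[of _ n n]) auto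
    then show ?thesis
      using vec_minus_eq_zero_iff[OF v mult_mat_vec_carrier[OF A v]] by auto
  qed
  then show ?thesis using mat_kernel[OF minus_carrier_mat[OF A]] by auto
qed

section \<open>Eigenvectors of M^H M for an idempotent M\<close>

text \<open>The cross term is <Mv, v> = <v, M^H v> = |v|^2, so the expansion of the square
  collapses.\<close>

lemma Re_norm_diff_fixed:
  fixes M :: "complex mat"
  assumes M: "M \<in> carrier_mat n n" and v: "v \<in> carrier_vec n"
    and fix_v: "mat_adjoint M *\<^sub>v v = v"
  shows "Re ((M *\<^sub>v v - v) \<bullet>c (M *\<^sub>v v - v)) = Re ((M *\<^sub>v v) \<bullet>c (M *\<^sub>v v)) - Re (v \<bullet>c v)"
  using Re_sprod_diff_self[of "M *\<^sub>v v" n v] adjoint_sprod[OF M v v] assms by simp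

text \<open>Since \<open>e\<close> is nonzero, \<open>v\<close> is a multiple of M^H (M v), hence
  lies in the range of M^H, which the idempotent M^H fixes pointwise.\<close>

lemma adjoint_fixes_eigenvector:
  fixes M :: "complex mat"
  assumes M: "M \<in> carrier_mat n n" and idem: "M * M = M" and v: "v \<in> carrier_vec n"
    and ev: "mat_adjoint M * M *\<^sub>v v = e \<cdot>\<^sub>v v" and e: "e \<noteq> 0"
  shows "mat_adjoint M *\<^sub>v v = v"
proof -
  let ?N = "mat_adjoint M"
  have N: "?N \<in> carrier_mat n n" using M by simp
  have idem': "?N * ?N = ?N" using mat_adjoint_mult[OF M M] idem by simp
  have "e \<cdot>\<^sub>v (?N *\<^sub>v v) = ?N *\<^sub>v (?N * M *\<^sub>v v)"
    using mult_mat_vec[OF N v, of e] ev by simp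
  also have "\<dots> = ?N * (?N * M) *\<^sub>v v"
    using N M v by (subst assoc_mult_mat_vec[of _ n n]) auto
  also have "?N * (?N * M) = ?N * M"
    using assoc_mult_mat[OF N N M] idem' by simp
  finally have "e \<cdot>\<^sub>v (?N *\<^sub>v v) = e \<cdot>\<^sub>v v" using ev by simp
  then have "inverse e \<cdot>\<^sub>v (e \<cdot>\<^sub>v (?N *\<^sub>v v)) = inverse e \<cdot>\<^sub>v (e \<cdot>\<^sub>v v)" by simp
  then show ?thesis using e by (simp add: smult_smult_assoc)
qed

text \<open>The right-hand side is symmetric in \<open>M\<close> and its adjoint, which later allows
  M^H M to be exchanged for M M^H. A vector fixed by M^H M is fixed by M^H, so |Mv| = |v| and
  therefore |Mv - v| = 0.\<close>

lemma mat_kernel_one_minus_adjoint_mult: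
  fixes M :: "complex mat"
  assumes M: "M \<in> carrier_mat n n" and idem: "M * M = M"
  shows "mat_kernel (1\<^sub>m n - mat_adjoint M * M) =
    {v \<in> carrier_vec n. M *\<^sub>v v = v \<and> mat_adjoint M *\<^sub>v v = v}"
proof -
  let ?N = "mat_adjoint M"
  have N: "?N \<in> carrier_mat n n" using M by simp
  have "M *\<^sub>v v = v \<and> ?N *\<^sub>v v = v" if v: "v \<in> carrier_vec n" and Hv: "?N * M *\<^sub>v v = v" for v
  proof
    show Nv: "?N *\<^sub>v v = v"
      using adjoint_fixes_eigenvector[OF M idem v, of 1] Hv by simp
    have "(M *\<^sub>v v) \<bullet>c (M *\<^sub>v v) = v \<bullet>c (?N *\<^sub>v (M *\<^sub>v v))"
      using adjoint_sprod[OF M v, of "M *\<^sub>v v"] M v by simp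
    also have "\<dots> = v \<bullet>c v" using Hv assoc_mult_mat_vec[OF N M v] by simp
    finally have "Re ((M *\<^sub>v v - v) \<bullet>c (M *\<^sub>v v - v)) = 0"
      using Re_norm_diff_fixed[OF M v Nv] by simp
    then have "(M *\<^sub>v v - v) \<bullet>c (M *\<^sub>v v - v) = 0"
      using sprod_self_eq_Re[of "M *\<^sub>v v - v"] by simp
    then have "M *\<^sub>v v - v = 0\<^sub>v n"
      using M v by (subst (asm) conjugate_square_eq_0_vec[of _ n]) auto
    then show "M *\<^sub>v v = v"
      using M v vec_minus_eq_zero_iff[of "M *\<^sub>v v" n v] by simp
  qed
  moreover have "?N * M *\<^sub>v v = v" if "v \<in> carrier_vec n" "M *\<^sub>v v = v" "?N *\<^sub>v v = v" for v
    using that assoc_mult_mat_vec[OF N M that(1)] by simp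
  ultimately show ?thesis
    unfolding mat_kernel_one_minus[OF mult_carrier_mat[OF N M]] by blast
qed

text \<open>For an eigenvector \<open>v\<close>, |Mv|^2 is \<open>cnj e\<close> times |v|^2. As both
  squares are real and |v| is positive, \<open>e\<close> is real; as |Mv|^2 - |v|^2 = |Mv - v|^2 is
  nonnegative, \<open>e\<close> is at least 1.\<close>

lemma eigenvalue_adjoint_mult_idempotent:
  fixes M :: "complex mat"
  assumes M: "M \<in> carrier_mat n n" and idem: "M * M = M"
    and ev: "eigenvalue (mat_adjoint M * M) e" and e: "e \<noteq> 0"
  shows "Im e = 0 \<and> Re e \<ge> 1"
proof -
  let ?N = "mat_adjoint M"
  have N: "?N \<in> carrier_mat n n" using M by simp
  from ev obtain v where v: "v \<in> carrier_vec n" and v0: "v \<noteq> 0\<^sub>v n"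
    and Hv: "?N * M *\<^sub>v v = e \<cdot>\<^sub>v v"
    using M by (auto simp: eigenvalue_def eigenvector_def)
  have Nv: "?N *\<^sub>v v = v" by (rule adjoint_fixes_eigenvector[OF M idem v Hv e])
  define a where "a = Re (v \<bullet>c v)"
  define b where "b = Re ((M *\<^sub>v v) \<bullet>c (M *\<^sub>v v))"
  have a: "v \<bullet>c v = of_real a" and b: "(M *\<^sub>v v) \<bullet>c (M *\<^sub>v v) = of_real b"
    unfolding a_def b_def by (rule sprod_self_eq_Re)+
  have "a \<noteq> 0" using v0 conjugate_square_eq_0_vec[OF v] a by simp
  then have "a > 0" using Re_sprod_self_nonneg[of v] unfolding a_def by linarith
  have "of_real b = v \<bullet>c (?N *\<^sub>v (M *\<^sub>v v))"
    using adjoint_sprod[OF M v, of "M *\<^sub>v v"] M v b by simp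
  also have "?N *\<^sub>v (M *\<^sub>v v) = e \<cdot>\<^sub>v v" using Hv assoc_mult_mat_vec[OF N M v] by simp
  also have "v \<bullet>c (e \<cdot>\<^sub>v v) = cnj e * (v \<bullet>c v)"
    using v by (simp add: conjugate_smult_vec)
  also note a
  finally have eq: "of_real b = cnj e * of_real a" .
  have "b = Re e * a" "Im e * a = 0"
    using arg_cong[OF eq, of Re] arg_cong[OF eq, of Im] by simp_all
  moreover have "b - a \<ge> 0"
    using Re_norm_diff_fixed[OF M v Nv] Re_sprod_self_nonneg[of "M *\<^sub>v v - v"]
    by (simp add: a_def b_def)
  ultimately have "Im e = 0" "1 * a \<le> Re e * a" using \<open>a > 0\<close> by simp_all
  then show ?thesis using \<open>a > 0\<close> mult_right_le_imp_le by blast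
qed

section \<open>Counting in multisets\<close>

lemma size_partition_zero_one_gt_one:
  fixes S :: "real multiset"
  assumes "\<And>s. s \<in># S \<Longrightarrow> s = 0 \<or> s = 1 \<or> s > 1"
  shows "size S = size {# s \<in># S. s > 1 #} + count S 1 + count S 0"
  using assms
proof (induction S)
  case (add s S)
  then have "s = 0 \<or> s = 1 \<or> s > 1" by simp
  with add show ?case by auto
qed simp

text \<open>Injectivity is asked only at \<open>x\<close> and against members of \<open>P\<close>,
  because the map from eigenvalues to singular values is not injective on all complex
  numbers.\<close>

lemma count_image_mset_eq:
  assumes "\<And>z. z \<in># P \<Longrightarrow> f z = f x \<longleftrightarrow> z = x"
  shows "count (image_mset f P) (f x) = count P x"
  using assms by (induction P) auto

theorem mainTheorem2:
  fixes M :: "complex mat" and n r :: nat and t :: int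
  assumes "M \<in> carrier_mat n n"
    and "M * M = M"
    and "r = vec_space.rank n M"
    and "t = int (vec_space.rank n M) - int (kernel_dim (1\<^sub>m n - M * mat_adjoint M))"
  shows "int (size {# s \<in># singular_values M. s > 1 #}) = t
    \<and> int (count (singular_values M) 1) = int r - t
    \<and> int r - t = int (kernel_dim (1\<^sub>m n - M * mat_adjoint M))
    \<and> int (count (singular_values M) 0) = int n - int r"
proof -
  note M = assms(1) and idem = assms(2)
  let ?N = "mat_adjoint M"
  let ?H = "?N * M"
  let ?P = "proots (char_poly ?H)"
  have N: "?N \<in> carrier_mat n n" and H: "?H \<in> carrier_mat n n"
    using M by auto
  have idem': "?N * ?N = ?N" using mat_adjoint_mult[OF M M] idem by simp
  have adj: "mat_adjoint ?H = ?H" using mat_adjoint_mult[OF N M] by simp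
  have nz: "char_poly ?H \<noteq> 0" using degree_monic_char_poly[OF H] by auto
  have root: "z = 0 \<or> (Im z = 0 \<and> Re z \<ge> 1)" if "z \<in># ?P" for z
  proof -
    have "eigenvalue ?H z"
      using that nz unfolding eigenvalue_root_char_poly[OF H] by simp
    then show ?thesis using eigenvalue_adjoint_mult_idempotent[OF M idem] by blast
  qed
  have "count (singular_values M) 0 = count ?P 0"
  proof -
    \<comment> \<open>A nonzero root has real part at least 1, so only the root 0 yields the
      singular value 0.\<close>
    have "sqrt (Re z) = sqrt (Re 0) \<longleftrightarrow> z = 0" if "z \<in># ?P" for z
      using root[OF that] by auto
    from count_image_mset_eq[of ?P "\<lambda>z. sqrt (Re z)" 0, OF this] show ?thesis
      by (simp add: singular_values_def)
  qed
  also have "\<dots> = kernel_dim (char_matrix ?H 0)"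
    using order_char_poly_selfadjoint[OF H adj, of 0] nz by simp
  also have "\<dots> = kernel_dim M"
  proof (rule kernel_dim_cong)
    have "char_matrix ?H 0 = ?H" using H by (auto simp: char_matrix_def)
    then show "mat_kernel (char_matrix ?H 0) = mat_kernel M"
      using mat_kernel_adjoint_mult_self[OF M] by simp
  qed (use M in \<open>simp add: char_matrix_def\<close>)
  finally have zero: "count (singular_values M) 0 + r = n"
    using rank_plus_kernel_dim[OF M] assms(3) by simp

  have "count (singular_values M) 1 = count ?P 1"
  proof -
    \<comment> \<open>A root with real part 1 is nonzero, hence real, hence equal to 1.\<close>
    have "sqrt (Re z) = sqrt (Re 1) \<longleftrightarrow> z = 1" if "z \<in># ?P" for z
      using root[OF that] by (auto simp: complex_eq_iff)
    from count_image_mset_eq[of ?P "\<lambda>z. sqrt (Re z)" 1, OF this] show ?thesis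
      by (simp add: singular_values_def)
  qed
  also have "\<dots> = kernel_dim (char_matrix ?H 1)"
    using order_char_poly_selfadjoint[OF H adj, of 1] nz by simp
  also have "\<dots> = kernel_dim (1\<^sub>m n - M * ?N)"
  proof (rule kernel_dim_cong)
    have "mat_kernel (char_matrix ?H 1) = mat_kernel (1\<^sub>m n - ?H)"
      unfolding mat_kernel_char_matrix[OF H] mat_kernel_one_minus[OF H] by simp
    also have "\<dots> = mat_kernel (1\<^sub>m n - M * ?N)"
      \<comment> \<open>Both kernels are the common fixed points of \<open>M\<close> and
        \<open>?N\<close>: the lemma is applied to \<open>M\<close> and to the idempotent
        \<open>?N\<close>, whose adjoint is \<open>M\<close>.\<close>
      using mat_kernel_one_minus_adjoint_mult[OF M idem]
        mat_kernel_one_minus_adjoint_mult[OF N idem'] by auto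
    finally show "mat_kernel (char_matrix ?H 1) = mat_kernel (1\<^sub>m n - M * ?N)" .
  qed (use M in \<open>simp add: char_matrix_def\<close>)
  finally have one: "count (singular_values M) 1 = kernel_dim (1\<^sub>m n - M * ?N)" .

  have "s = 0 \<or> s = 1 \<or> s > 1" if s: "s \<in># singular_values M" for s
  proof -
    obtain z where "z \<in># ?P" "s = sqrt (Re z)"
      using s by (auto simp: singular_values_def)
    then show ?thesis using root[of z] by auto
  qed
  \<comment> \<open>Of the n singular values, n - r are 0 and
    \<open>kernel_dim (1\<^sub>m n - M * ?N)\<close> are 1; the remaining \<open>t\<close> exceed
    1.\<close>
  from size_partition_zero_one_gt_one[OF this] show ?thesis
    using size_singular_values[OF M] zero one assms(3,4) by simp
qed

end
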